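(* Let $T$ be a statistic with values in a space $\mathbb{T}$ and sampling distribution $\mathsf{P}_{T|\theta}$, $\theta \in \Theta$, represented by a function $a: \mathbb{U} \times \Theta \to \mathbb{T}$ and a probability measure $\mathsf{P}_U$ on $\mathbb{U}$ in the sense that, for each $\theta \in \Theta$, $a(U,\theta) \sim \mathsf{P}_{T|\theta}$ when $U \sim \mathsf{P}_U$. Let $\Theta_t(u) = \{\theta \in \Theta : t = a(u,\theta)\}$ for $t\in\mathbb{T}$, $u\in\mathbb{U}$, and let $\mathcal{S}$ be a predictive random set on $\mathbb{U}$ with distribution $\mathsf{P}_{\mathcal{S}}$. Define $\Theta_t(\mathcal{S}) = \bigcup_{u \in \mathcal{S}} \Theta_t(u)$, $\mathsf{pl}_t(\theta) = \mathsf{P}_{\mathcal{S}}\{\Theta_t(\mathcal{S}) \ni \theta\}$, and, for $\alpha \in (0,1)$, the plausibility region $\mathscr{P}_\alpha(t) = \{\theta \in \Theta: \mathsf{pl}_t(\theta) > \alpha\}$. If $\mathcal{S}$ is valid and $\Theta_t(u) \neq \varnothing$ for all pairs $(t,u)$, then for any $\alpha \in (0,1)$ the coverage probability of $\mathscr{P}_\alpha(T)$ is at least $1-\alpha$, i.e., $$\mathsf{P}_{T|\theta}\{\mathscr{P}_\alpha(T) \ni \theta\} \geq 1-\alpha \quad \text{for all } \theta \in \Theta.$$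
   Context: Setting: $\mathbb{U}$ is a (topological) auxiliary variable space equipped with a $\sigma$-algebra $\mathscr{U}$ containing all closed sets and a probability measure $\mathsf{P}_U$. A predictive random set $\mathcal{S}$ is a random set with distribution $\mathsf{P}_{\mathcal{S}}$ whose possible realizations form a collection $\mathbb{S}$ (its support) of closed subsets of $\mathbb{U}$ with $\varnothing,\mathbb{U} \in \mathbb{S}$. Probabilities written are assumed to be well defined (measurability technicalities are ignored). Contour function: $f_{\mathcal{S}}(u) = \mathsf{P}_{\mathcal{S}}\{\mathcal{S} \ni u\}$ for $u \in \mathbb{U}$. Stochastically no smaller than $\mathsf{Unif}(0,1)$: a $[0,1]$-valued random variable $X$ has this property if $\mathsf{P}\{X \leq \alpha\} \leq \alpha$ for all $\alpha \in (0,1)$. Valid: $\mathcal{S}$ is valid if $f_{\mathcal{S}}(U)$ is stochastically no smaller than $\mathsf{Unif}(0,1)$ when $U \sim \mathsf{P}_U$. *)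

theory Defs
  imports "HOL-Probability.Probability"
begin

definition stoch_no_smaller_unif :: "'w measure \<Rightarrow> ('w \<Rightarrow> real) \<Rightarrow> bool" where
  "stoch_no_smaller_unif M X \<longleftrightarrow>
     X \<in> borel_measurable M \<and>
     (\<forall>w\<in>space M. 0 \<le> X w \<and> X w \<le> 1) \<and>
     (\<forall>\<alpha>\<in>{0<..<1}. measure M {w \<in> space M. X w \<le> \<alpha>} \<le> \<alpha>)"

definition auxiliary_space :: "'u topology \<Rightarrow> 'u measure \<Rightarrow> bool" where
  "auxiliary_space U PU \<longleftrightarrow>
     prob_space PU \<and> space PU = topspace U \<and> (\<forall>F. closedin U F \<longrightarrow> F \<in> sets PU)"

(* A random set is represented by its distribution PS, a probability measure whose
   underlying space is the collection of possible realizations. The last conjunct makes the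
   probabilities in the contour function well defined. *)
definition predictive_random_set :: "'u topology \<Rightarrow> 'u set measure \<Rightarrow> bool" where
  "predictive_random_set U PS \<longleftrightarrow>
     prob_space PS \<and>
     (\<forall>S\<in>space PS. closedin U S) \<and>
     {} \<in> space PS \<and> topspace U \<in> space PS \<and>
     (\<forall>u\<in>topspace U. {S \<in> space PS. u \<in> S} \<in> sets PS)"

definition contour :: "'u set measure \<Rightarrow> 'u \<Rightarrow> real" where
  "contour PS u = measure PS {S \<in> space PS. u \<in> S}"

definition valid_prs :: "'u measure \<Rightarrow> 'u set measure \<Rightarrow> bool" where
  "valid_prs PU PS \<longleftrightarrow> stoch_no_smaller_unif PU (contour PS)"

(* Of TT only the space and the sigma-algebra matter; its measure is never used.
   a(U,\<theta>) ~ PT \<theta> is expressed by the push-forward of PU. *)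
definition represents_sampling ::
    "'u measure \<Rightarrow> 't measure \<Rightarrow> 'p set \<Rightarrow> ('u \<times> 'p \<Rightarrow> 't) \<Rightarrow> ('p \<Rightarrow> 't measure) \<Rightarrow> bool" where
  "represents_sampling PU TT \<Theta> a PT \<longleftrightarrow>
     a \<in> space PU \<times> \<Theta> \<rightarrow> space TT \<and>
     (\<forall>\<theta>\<in>\<Theta>. (\<lambda>u. a (u, \<theta>)) \<in> measurable PU TT \<and> distr PU TT (\<lambda>u. a (u, \<theta>)) = PT \<theta>)"

definition focal_pt :: "'p set \<Rightarrow> ('u \<times> 'p \<Rightarrow> 't) \<Rightarrow> 't \<Rightarrow> 'u \<Rightarrow> 'p set" where
  "focal_pt \<Theta> a t u = {\<theta> \<in> \<Theta>. t = a (u, \<theta>)}"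

definition focal_set :: "'p set \<Rightarrow> ('u \<times> 'p \<Rightarrow> 't) \<Rightarrow> 't \<Rightarrow> 'u set \<Rightarrow> 'p set" where
  "focal_set \<Theta> a t S = (\<Union>u\<in>S. focal_pt \<Theta> a t u)"

definition pl :: "'u set measure \<Rightarrow> 'p set \<Rightarrow> ('u \<times> 'p \<Rightarrow> 't) \<Rightarrow> 't \<Rightarrow> 'p \<Rightarrow> real" where
  "pl PS \<Theta> a t \<theta> = measure PS {S \<in> space PS. \<theta> \<in> focal_set \<Theta> a t S}"

definition pl_region ::
    "'u set measure \<Rightarrow> 'p set \<Rightarrow> ('u \<times> 'p \<Rightarrow> 't) \<Rightarrow> real \<Rightarrow> 't \<Rightarrow> 'p set" where
  "pl_region PS \<Theta> a \<alpha> t = {\<theta> \<in> \<Theta>. pl PS \<Theta> a t \<theta> > \<alpha>}"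

end

theory Submission
  imports Defs
begin

text \<open>
  If the data are generated as \<open>t = a (u, \<theta>)\<close> with \<open>\<theta>\<close> the true parameter, then any realization
  of the random set that hits the actual \<open>u\<close> has \<open>\<theta>\<close> in its focal set. Hence the plausibility of
  the true parameter dominates the contour function at the \<open>u\<close> that produced the data
  (\<open>contour_le_pl\<close>). Validity says that the contour function at a random \<open>u\<close> exceeds \<open>\<alpha>\<close> with
  probability at least \<open>1 - \<alpha>\<close> (\<open>prob_greater_stoch_no_smaller_unif\<close>), and therefore so does the
  plausibility. Since the sampling distribution is the law of \<open>a (U, \<theta>)\<close>, this is the coverage
  probability.
\<close>

text \<open>
  The focal set is a union over the points of the realization, and \<open>u\<close> alone already contributes
  \<open>\<theta>\<close> when \<open>t = a (u, \<theta>)\<close>. Measurability of the larger event is a hypothesis because \<open>measure\<close>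
  is \<open>0\<close> off the \<open>\<sigma>\<close>-algebra, so monotonicity would otherwise fail.
\<close>

lemma contour_le_pl:
  assumes "prob_space PS" and "\<theta> \<in> \<Theta>"
    and "{S \<in> space PS. \<theta> \<in> focal_set \<Theta> a (a (u, \<theta>)) S} \<in> sets PS"
  shows "contour PS u \<le> pl PS \<Theta> a (a (u, \<theta>)) \<theta>"
proof -
  interpret prob_space PS by fact
  have "{S \<in> space PS. u \<in> S} \<subseteq> {S \<in> space PS. \<theta> \<in> focal_set \<Theta> a (a (u, \<theta>)) S}"
    using assms(2) by (auto simp: focal_set_def focal_pt_def)
  then show ?thesis
    unfolding contour_def pl_def using assms(3) by (rule finite_measure_mono)
qed

lemma prob_greater_stoch_no_smaller_unif:
  assumes "prob_space M" and "stoch_no_smaller_unif M X" and "0 < \<alpha>" and "\<alpha> < 1"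
  shows "1 - \<alpha> \<le> measure M {w \<in> space M. \<alpha> < X w}"
proof -
  interpret prob_space M by fact
  have [measurable]: "X \<in> borel_measurable M"
    using assms(2) by (simp add: stoch_no_smaller_unif_def)
  have "measure M {w \<in> space M. \<alpha> < X w} = 1 - measure M {w \<in> space M. X w \<le> \<alpha>}"
    by (subst prob_neg[symmetric]) (auto simp: not_le)
  moreover have "measure M {w \<in> space M. X w \<le> \<alpha>} \<le> \<alpha>"
    using assms by (auto simp: stoch_no_smaller_unif_def)
  ultimately show ?thesis by simp
qed

theorem mainTheorem3:
  fixes U :: "'u topology" and PU :: "'u measure" and PS :: "'u set measure"
    and TT :: "'t measure" and \<Theta> :: "'p set" and PT :: "'p \<Rightarrow> 't measure"
    and a :: "'u \<times> 'p \<Rightarrow> 't" and \<alpha> :: real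
  assumes aux: "auxiliary_space U PU"
    and sampling_prob: "\<And>\<theta>. \<theta> \<in> \<Theta> \<Longrightarrow> prob_space (PT \<theta>) \<and> sets (PT \<theta>) = sets TT"
    and repr: "represents_sampling PU TT \<Theta> a PT"
    and prs: "predictive_random_set U PS"
    and valid: "valid_prs PU PS"
    and nonempty: "\<And>t u. t \<in> space TT \<Longrightarrow> u \<in> topspace U \<Longrightarrow> focal_pt \<Theta> a t u \<noteq> {}"
    and alpha: "0 < \<alpha>" "\<alpha> < 1"
    and pl_well_defined: "\<And>t \<theta>. t \<in> space TT \<Longrightarrow> \<theta> \<in> \<Theta> \<Longrightarrow>
      {S \<in> space PS. \<theta> \<in> focal_set \<Theta> a t S} \<in> sets PS"
    and coverage_well_defined: "\<And>\<theta>. \<theta> \<in> \<Theta> \<Longrightarrow>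
      {t \<in> space TT. \<theta> \<in> pl_region PS \<Theta> a \<alpha> t} \<in> sets TT"
  shows "\<forall>\<theta>\<in>\<Theta>. measure (PT \<theta>) {t \<in> space (PT \<theta>). \<theta> \<in> pl_region PS \<Theta> a \<alpha> t} \<ge> 1 - \<alpha>"
proof
  fix \<theta> assume \<theta>: "\<theta> \<in> \<Theta>"
  interpret PU: prob_space PU
    using aux by (simp add: auxiliary_space_def)
  have PS: "prob_space PS"
    using prs by (simp add: predictive_random_set_def)
  let ?A = "\<lambda>u. a (u, \<theta>)"
  have A: "?A \<in> measurable PU TT" and PT: "PT \<theta> = distr PU TT ?A"
    using repr \<theta> by (auto simp: represents_sampling_def)
  let ?C = "{t \<in> space TT. \<theta> \<in> pl_region PS \<Theta> a \<alpha> t}"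
  have C: "?C \<in> sets TT"
    using coverage_well_defined \<theta> .
  have "1 - \<alpha> \<le> measure PU {u \<in> space PU. \<alpha> < contour PS u}"
    using PU.prob_space_axioms valid alpha
    unfolding valid_prs_def by (rule prob_greater_stoch_no_smaller_unif)
  also have "\<dots> \<le> measure PU (?A -` ?C \<inter> space PU)"
  proof (rule PU.finite_measure_mono)
    show "{u \<in> space PU. \<alpha> < contour PS u} \<subseteq> ?A -` ?C \<inter> space PU"
    proof
      fix u assume "u \<in> {u \<in> space PU. \<alpha> < contour PS u}"
      then have u: "u \<in> space PU" and less: "\<alpha> < contour PS u"
        by auto
      have t: "?A u \<in> space TT"
        using A u by (rule measurable_space)
      have "contour PS u \<le> pl PS \<Theta> a (?A u) \<theta>"
        using PS \<theta> pl_well_defined[OF t \<theta>] by (rule contour_le_pl)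
      then show "u \<in> ?A -` ?C \<inter> space PU"
        using u less t \<theta> by (simp add: pl_region_def)
    qed
    show "?A -` ?C \<inter> space PU \<in> sets PU"
      using A C by (rule measurable_sets)
  qed
  also have "\<dots> = measure (PT \<theta>) ?C"
    unfolding PT using A C by (rule measure_distr[symmetric])
  also have "?C = {t \<in> space (PT \<theta>). \<theta> \<in> pl_region PS \<Theta> a \<alpha> t}"
    by (simp add: PT)
  finally show "1 - \<alpha> \<le> measure (PT \<theta>) {t \<in> space (PT \<theta>). \<theta> \<in> pl_region PS \<Theta> a \<alpha> t}" .
qed

end
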